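(* Let $C, A_1,\dots,A_m$ be real symmetric $n\times n$ matrices, let the linear matrix inequality $C - \sum_{i=1}^m A_i x_i \succeq 0$ be bounded (i.e. its solution set is bounded) and assume that Slater's condition holds. Let $P = \{x \in \mathbb{R}^m : C - \sum_{i=1}^m A_i x_i \succeq 0\}$. Then $C - \sum_{i=1}^m A_i x_i \succeq 0$ is totally dual integral on $\mathbb{Z}^m$ if and only if there exists some finite set of integer positive semidefinite matrices $\mathcal{V} = \{V_1,\dots,V_k\}$ such that for each extreme point $\bar{x}$ of $P$ with $K(\bar{x}) \cap \mathbb{Z}^m \neq \emptyset$, the vectors $$g_j := (\langle A_1, V_j\rangle, \dots, \langle A_m, V_j\rangle)^\top \quad \text{for } j \in J := \{j \in [k] : \mathrm{Col}(V_j) \subseteq \mathcal{R}_{\bar{x}}\}$$ form a Hilbert basis of $K(\bar{x})$.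
   Context: $[k]=\{1,\dots,k\}$, $\langle X,Y\rangle = \mathrm{tr}(X^\top Y)$, $\succeq 0$ (resp. $\succ 0$) denotes positive semidefinite (resp. positive definite), $\mathrm{Col}$ is the column space and $\mathrm{Nul}$ the null space. Slater's condition: there is $x \in \mathbb{R}^m$ with $C - \sum_i A_i x_i \succ 0$. For an extreme point $\bar{x}$ of $P$: $\mathcal{R}_{\bar{x}} := \mathrm{Nul}(C - \sum_{i=1}^m A_i \bar{x}_i)$, and $K(\bar{x}) := \{b \in \mathbb{R}^m : b^\top \bar{x} = \max\{b^\top x : x \in P\}\}$ (the normal cone of $P$ at $\bar x$). Hilbert basis: a set $\{v_1,\dots,v_r\} \subseteq \mathbb{Z}^m$ is a Hilbert basis if every integral vector $x \in \mathrm{cone}(\{v_1,\dots,v_r\})$ can be written as $x = \sum_{j=1}^r \alpha_j v_j$ with $\alpha_j \ge 0$, $\alpha_j \in \mathbb{Z}$. It is a Hilbert basis of a cone $K$ if moreover $\mathrm{cone}(\{v_1,\dots,v_r\}) = K$. Property $(\mathrm{P}\mathbb{Z})_{\mathcal{V}}$: given a finite set $\mathcal{V} = \{V_1,\dots,V_k\}$ of positive semidefinite $n\times n$ matrices with integer entries, a positive semidefinite matrix $X$ satisfies $(\mathrm{P}\mathbb{Z})_{\mathcal{V}}$ if $X = \sum_{j \in [k]} y_j V_j$ for some $y \in \mathbb{Z}^k_+$ (nonnegative integers). Total dual integrality: the LMI $C - \sum_{i=1}^m A_i x_i \succeq 0$ is totally dual integral on $Z \subseteq \mathbb{Z}^m$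 if there exists a finite set $\mathcal{V}$ of integer positive semidefinite matrices such that, for every $b \in Z$, the dual semidefinite program $\inf\{\langle C, X\rangle : \langle A_i, X\rangle = b_i\ (i \in [m]),\ X \succeq 0\}$ of $\sup\{b^\top x : C - \sum_{i} A_i x_i \succeq 0\}$ has an optimal solution satisfying $(\mathrm{P}\mathbb{Z})_{\mathcal{V}}$ whenever it has an optimal solution. *)

theory Defs
  imports "HOL-Analysis.Analysis"
begin

definition psd :: "real^'n^'n \<Rightarrow> bool" where
  "psd M \<longleftrightarrow> transpose M = M \<and> (\<forall>v. 0 \<le> v \<bullet> (M *v v))"

definition pos_def :: "real^'n^'n \<Rightarrow> bool" where
  "pos_def M \<longleftrightarrow> transpose M = M \<and> (\<forall>v. v \<noteq> 0 \<longrightarrow> 0 < v \<bullet> (M *v v))"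

definition trace_inner :: "real^'n^'n \<Rightarrow> real^'n^'n \<Rightarrow> real" where
  "trace_inner X Y = trace (transpose X ** Y)"

definition col_space :: "real^'n^'n \<Rightarrow> (real^'n) set" where
  "col_space M = span (columns M)"

definition null_space :: "real^'n^'n \<Rightarrow> (real^'n) set" where
  "null_space M = {v. M *v v = 0}"

definition int_vecs :: "(real^'m) set" where
  "int_vecs = {x. \<forall>i. x $ i \<in> \<int>}"

definition int_psd :: "real^'n^'n \<Rightarrow> bool" where
  "int_psd M \<longleftrightarrow> psd M \<and> (\<forall>i j. M $ i $ j \<in> \<int>)"

definition slack :: "real^'n^'n \<Rightarrow> ('m::finite \<Rightarrow> real^'n^'n) \<Rightarrow> real^'m \<Rightarrow> real^'n^'n" where
  "slack C A x = C - (\<Sum>i\<in>UNIV. x $ i *\<^sub>R A i)"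

definition lmi_solutions :: "real^'n^'n \<Rightarrow> ('m::finite \<Rightarrow> real^'n^'n) \<Rightarrow> (real^'m) set" where
  "lmi_solutions C A = {x. psd (slack C A x)}"

definition slater :: "real^'n^'n \<Rightarrow> ('m::finite \<Rightarrow> real^'n^'n) \<Rightarrow> bool" where
  "slater C A \<longleftrightarrow> (\<exists>x. pos_def (slack C A x))"

definition normal_cone :: "(real^'m) set \<Rightarrow> real^'m \<Rightarrow> (real^'m) set" where
  "normal_cone P xbar = {b. xbar \<in> P \<and> (\<forall>x\<in>P. b \<bullet> x \<le> b \<bullet> xbar)}"

text \<open>
  Coefficients of type \<open>nat\<close> encode nonnegative integers.  The convex cone hull of the
  empty set is \<open>{0}\<close>, so the empty set is a Hilbert basis of the trivial cone.
\<close>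

definition hilbert_basis :: "(real^'m) set \<Rightarrow> bool" where
  "hilbert_basis S \<longleftrightarrow> finite S \<and> S \<subseteq> int_vecs \<and>
     (\<forall>x \<in> (convex_cone hull S) \<inter> int_vecs.
        \<exists>\<alpha> :: real^'m \<Rightarrow> nat. x = (\<Sum>v\<in>S. real (\<alpha> v) *\<^sub>R v))"

definition hilbert_basis_of :: "(real^'m) set \<Rightarrow> (real^'m) set \<Rightarrow> bool" where
  "hilbert_basis_of S K \<longleftrightarrow> hilbert_basis S \<and> convex_cone hull S = K"

definition property_PZ :: "(real^'n^'n) set \<Rightarrow> real^'n^'n \<Rightarrow> bool" where
  "property_PZ \<V> X \<longleftrightarrow> psd X \<and>
     (\<exists>y :: real^'n^'n \<Rightarrow> nat. X = (\<Sum>V\<in>\<V>. real (y V) *\<^sub>R V))"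

definition dual_feasible :: "('m::finite \<Rightarrow> real^'n^'n) \<Rightarrow> real^'m \<Rightarrow> real^'n^'n \<Rightarrow> bool" where
  "dual_feasible A b X \<longleftrightarrow> psd X \<and> (\<forall>i. trace_inner (A i) X = b $ i)"

definition dual_optimal ::
  "real^'n^'n \<Rightarrow> ('m::finite \<Rightarrow> real^'n^'n) \<Rightarrow> real^'m \<Rightarrow> real^'n^'n \<Rightarrow> bool" where
  "dual_optimal C A b X \<longleftrightarrow> dual_feasible A b X \<and>
     (\<forall>Y. dual_feasible A b Y \<longrightarrow> trace_inner C X \<le> trace_inner C Y)"

definition totally_dual_integral_on ::
  "real^'n^'n \<Rightarrow> ('m::finite \<Rightarrow> real^'n^'n) \<Rightarrow> (real^'m) set \<Rightarrow> bool" where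
  "totally_dual_integral_on C A Z \<longleftrightarrow>
     (\<exists>\<V>. finite \<V> \<and> (\<forall>V\<in>\<V>. int_psd V) \<and>
        (\<forall>b\<in>Z. (\<exists>X. dual_optimal C A b X) \<longrightarrow>
               (\<exists>X. dual_optimal C A b X \<and> property_PZ \<V> X)))"

definition constraint_vec :: "('m::finite \<Rightarrow> real^'n^'n) \<Rightarrow> real^'n^'n \<Rightarrow> real^'m" where
  "constraint_vec A V = (\<chi> i. trace_inner (A i) V)"

end

theory Submission
  imports Defs
begin

text \<open>
  By Slater's condition and boundedness, every \<open>b\<close> has a dual optimal solution whose value is
  the support function \<open>h\<close> of the solution set \<open>P\<close>. If \<open>x\<close> maximizes \<open>b\<close> over \<open>P\<close>, a dual feasible
  \<open>X\<close> is optimal iff it is orthogonal to the slack matrix at \<open>x\<close>; a nonnegative combination of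
  the \<open>V\<^sub>j\<close> therefore only involves matrices with column space inside the kernel of that slack.
  So, for integral \<open>b\<close>, an optimal solution with the required property is the same thing as an
  integral conic representation of \<open>b\<close> by active constraint vectors. Given a Hilbert basis of
  each normal cone, total dual integrality follows because \<open>b\<close> lies in the normal cone of an
  extreme point. Conversely, the points \<open>(b, h b)\<close> with integral \<open>b\<close> lie in the closed cone
  generated by the \<open>(g\<^sub>j, \<langle>C, V\<^sub>j\<rangle>)\<close>; by scaling and continuity this holds for every real \<open>b\<close>,
  hence the active \<open>g\<^sub>j\<close> generate the whole normal cone.
\<close>

section \<open>Positive semidefinite matrices\<close>

lemma trace_inner_eq: "trace_inner X Y = X \<bullet> Y"
  unfolding trace_inner_def trace_def matrix_matrix_mult_def transpose_def inner_vec_def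
  by (simp, rule sum.swap)

lemma symmetric_matrix_entry:
  assumes "transpose M = M"
  shows "M $ i $ j = M $ j $ i"
proof -
  have "transpose M $ i $ j = M $ j $ i" by (simp add: transpose_def)
  then show ?thesis using assms by simp
qed

lemma inner_symmetric_matrix:
  fixes M :: "real^'n^'n"
  assumes "transpose M = M"
  shows "(M *v u) \<bullet> v = u \<bullet> (M *v v)"
  by (metis assms dot_lmul_matrix transpose_matrix_vector)

text \<open>The quadratic form at \<open>u + s *\<^sub>R w\<close> is nonnegative for every real
  \<open>s\<close>, so its discriminant is not positive. If its leading coefficient vanishes, it is
  affine in \<open>s\<close> and the linear coefficient must vanish too.\<close>

lemma psd_Cauchy_Schwarz:
  fixes M :: "real^'n^'n"
  assumes "psd M"
  shows "(u \<bullet> (M *v w))\<^sup>2 \<le> (u \<bullet> (M *v u)) * (w \<bullet> (M *v w))"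
proof -
  let ?a = "u \<bullet> (M *v u)" and ?t = "u \<bullet> (M *v w)" and ?c = "w \<bullet> (M *v w)"
  have sym: "w \<bullet> (M *v u) = ?t"
    using assms inner_symmetric_matrix[of M u w] by (simp add: psd_def inner_commute)
  have q: "0 \<le> ?a + 2 * s * ?t + s\<^sup>2 * ?c" for s
  proof -
    have "0 \<le> (u + s *\<^sub>R w) \<bullet> (M *v (u + s *\<^sub>R w))"
      using assms by (simp add: psd_def)
    also have "\<dots> = ?a + 2 * s * ?t + s\<^sup>2 * ?c"
      by (simp add: matrix_vector_right_distrib matrix_vector_mult_scaleR inner_left_distrib
          inner_right_distrib sym power2_eq_square algebra_simps)
    finally show ?thesis .
  qed
  have c: "0 \<le> ?c" using assms by (simp add: psd_def)
  show ?thesis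
  proof (cases "?c = 0")
    case True
    have "?t = 0"
    proof (rule ccontr)
      assume "?t \<noteq> 0"
      \<comment> \<open>At this \<open>s\<close> the affine form takes the value -1.\<close>
      then show False using q[of "- (?a + 1) / (2 * ?t)"] True by (simp add: field_simps)
    qed
    then show ?thesis using True by simp
  next
    case False
    \<comment> \<open>The chosen \<open>s\<close> is the minimizer of the quadratic.\<close>
    then have "0 \<le> ?a - ?t\<^sup>2 / ?c" using q[of "- ?t / ?c"]
      by (simp add: power2_eq_square)
    then show ?thesis using False c by (simp add: field_simps)
  qed
qed

section \<open>Rank-one matrices and Cholesky induction\<close>

definition outer :: "real^'n \<Rightarrow> real^'n^'n" where
  "outer v = (\<chi> i j. v $ i * v $ j)"

lemma outer_mult_vec: "outer v *v u = (v \<bullet> u) *\<^sub>R v"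
  by (simp add: outer_def matrix_vector_mult_def vec_eq_iff inner_vec_def sum_distrib_left mult_ac)

lemma transpose_outer: "transpose (outer v) = outer v"
  by (simp add: outer_def transpose_def vec_eq_iff mult.commute)

lemma psd_outer: "psd (outer v)"
  by (simp add: psd_def outer_mult_vec transpose_outer inner_commute[of _ v])

lemma inner_outer: "Y \<bullet> outer v = v \<bullet> (Y *v v)"
  by (simp add: inner_vec_def outer_def matrix_vector_mult_def sum_distrib_left algebra_simps)

lemma trace_outer: "trace (outer v) = v \<bullet> v"
  by (simp add: trace_def outer_def inner_vec_def)

lemma norm_outer: "norm (outer v) = v \<bullet> v"
  by (simp add: norm_eq_sqrt_inner inner_outer outer_mult_vec)

lemma psd_add: "psd X \<Longrightarrow> psd Y \<Longrightarrow> psd (X + Y)"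
  by (auto simp: psd_def transpose_def vec_eq_iff matrix_vector_mult_add_rdistrib inner_right_distrib)

lemma psd_scaleR: "psd X \<Longrightarrow> 0 \<le> c \<Longrightarrow> psd (c *\<^sub>R X)"
  by (auto simp: psd_def transpose_def vec_eq_iff scaleR_matrix_vector_assoc[symmetric])

lemma psd_0: "psd 0"
  by (simp add: psd_def transpose_def vec_eq_iff)

lemma psd_entry_sq_le:
  assumes "psd X"
  shows "(X $ i $ j)\<^sup>2 \<le> X $ i $ i * X $ j $ j"
  using psd_Cauchy_Schwarz[OF assms, of "axis i 1" "axis j 1"]
  by (simp add: matrix_vector_mult_basis inner_axis' column_def)

text \<open>One Cholesky step subtracts a rank-one matrix and clears a diagonal entry.\<close>

lemma psd_induct [consumes 1, case_names zero add_outer]: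
  fixes X :: "real^'n^'n"
  assumes "psd X"
    and zero: "P 0"
    and add: "\<And>X v. psd X \<Longrightarrow> P X \<Longrightarrow> P (X + outer v)"
  shows "P X"
  using assms(1)
proof (induction "card {i. X $ i $ i \<noteq> 0}" arbitrary: X rule: less_induct)
  case less
  show ?case
  proof (cases "\<exists>k. X $ k $ k \<noteq> 0")
    case False
    then have "X = 0"
      using psd_entry_sq_le[OF less.prems] by (auto simp: vec_eq_iff)
    then show ?thesis using zero by simp
  next
    case True
    then obtain k where k: "X $ k $ k \<noteq> 0" by blast
    have diag: "X $ i $ i = axis i 1 \<bullet> (X *v axis i 1)" for i
      by (simp add: matrix_vector_mult_basis inner_axis' column_def)
    have kpos: "0 < X $ k $ k"
      using less.prems k diag[of k] unfolding psd_def by (metis order_less_le)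
    \<comment> \<open>With this scaling \<open>outer v\<close> agrees with \<open>X\<close> in row
      and column \<open>k\<close>. Cauchy-Schwarz against \<open>axis k 1\<close> then keeps the
      difference positive semidefinite.\<close>
    define v where "v = (1 / sqrt (X $ k $ k)) *\<^sub>R (X *v axis k 1)"
    let ?X = "X - outer v"
    have v2: "(u \<bullet> v)\<^sup>2 = (u \<bullet> (X *v axis k 1))\<^sup>2 / X $ k $ k" for u
      using kpos by (simp add: v_def power_divide)
    have vi: "(v $ i)\<^sup>2 = (X $ i $ k)\<^sup>2 / X $ k $ k" for i
      using kpos by (simp add: v_def power_divide matrix_vector_mult_basis column_def)
    have psd: "psd ?X"
      unfolding psd_def
    proof (intro conjI allI)
      show "transpose ?X = ?X"
        using less.prems transpose_outer[of v] by (simp add: psd_def transpose_def vec_eq_iff)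
      fix u
      have "u \<bullet> (?X *v u) = u \<bullet> (X *v u) - (u \<bullet> v)\<^sup>2"
        by (simp add: matrix_vector_mult_diff_rdistrib inner_diff_right outer_mult_vec
            power2_eq_square inner_commute)
      moreover have "(u \<bullet> v)\<^sup>2 \<le> u \<bullet> (X *v u)"
        using psd_Cauchy_Schwarz[OF less.prems, of u "axis k 1"] kpos
        unfolding v2 by (simp add: diag[symmetric] field_simps)
      ultimately show "0 \<le> u \<bullet> (?X *v u)" by simp
    qed
    have entry: "?X $ i $ i = X $ i $ i - (X $ i $ k)\<^sup>2 / X $ k $ k" for i
      using vi[of i] by (simp add: outer_def power2_eq_square)
    \<comment> \<open>A zero diagonal entry forces its whole row to vanish, so it stays zero after
      the subtraction; since entry \<open>k\<close> becomes zero, the number of nonzero diagonal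
      entries drops.\<close>
    have "?X $ i $ i = 0" if "X $ i $ i = 0" for i
      using psd_entry_sq_le[OF less.prems, of i k] that entry[of i] by simp
    moreover have "?X $ k $ k = 0"
      using k entry[of k] by (simp add: power2_eq_square)
    ultimately have "{i. ?X $ i $ i \<noteq> 0} \<subset> {i. X $ i $ i \<noteq> 0}"
      using k by blast
    then have "card {i. ?X $ i $ i \<noteq> 0} < card {i. X $ i $ i \<noteq> 0}"
      by (simp add: psubset_card_mono)
    from add[OF psd less.hyps[OF this psd], of v] show ?thesis by simp
  qed
qed

section \<open>Orthogonality of positive semidefinite matrices\<close>

lemma psd_inner_nonneg:
  assumes "psd X" "psd Y"
  shows "0 \<le> Y \<bullet> X"
  using assms(1)
proof (induction X rule: psd_induct)
  case (add_outer X v)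
  then show ?case using assms(2) by (simp add: inner_right_distrib inner_outer psd_def)
qed simp

lemma psd_mult_vec_eq_0:
  assumes "psd Y" "v \<bullet> (Y *v v) = 0"
  shows "Y *v v = 0"
  using psd_Cauchy_Schwarz[OF assms(1), of "Y *v v" v] assms(2) by simp

text \<open>Each rank-one summand \<open>outer v\<close> of \<open>X\<close> contributes a
  nonnegative amount to \<open>Y \<bullet> X\<close>. All contributions must vanish, which puts
  every such \<open>v\<close> into the kernel of \<open>Y\<close>.\<close>

lemma psd_inner_eq_0_mult_vec:
  assumes "psd X" "psd Y" "Y \<bullet> X = 0"
  shows "Y *v (X *v u) = 0"
  using assms(1,3)
proof (induction X rule: psd_induct)
  case (add_outer X v)
  have "0 \<le> Y \<bullet> X" "0 \<le> v \<bullet> (Y *v v)"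
    using add_outer assms(2) psd_inner_nonneg by (auto simp: psd_def)
  then have "Y \<bullet> X = 0" "v \<bullet> (Y *v v) = 0"
    using add_outer by (auto simp: inner_right_distrib inner_outer)
  then show ?case
    using add_outer.IH psd_mult_vec_eq_0[OF assms(2)]
    by (simp add: matrix_vector_mult_add_rdistrib matrix_vector_right_distrib outer_mult_vec
        matrix_vector_mult_scaleR)
qed simp

text \<open>Translates complementary slackness into the column space condition that selects the
  active matrices. Conversely, that condition gives \<open>Y ** X = 0\<close>, and the trace of this
  product is \<open>Y \<bullet> X\<close> because \<open>X\<close> is symmetric.\<close>

lemma psd_inner_eq_0_iff:
  assumes "psd X" "psd Y"
  shows "Y \<bullet> X = 0 \<longleftrightarrow> col_space X \<subseteq> null_space Y"
proof
  assume *: "Y \<bullet> X = 0"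
  have "subspace (null_space Y)"
    by (auto simp: subspace_def null_space_def matrix_vector_right_distrib matrix_vector_mult_scaleR)
  moreover have "columns X \<subseteq> null_space Y"
    using psd_inner_eq_0_mult_vec[OF assms *]
    by (auto simp: columns_def null_space_def matrix_vector_mult_basis[symmetric])
  ultimately show "col_space X \<subseteq> null_space Y"
    unfolding col_space_def by (rule span_minimal[rotated])
next
  assume *: "col_space X \<subseteq> null_space Y"
  have "Y *v column k X = 0" for k
  proof -
    have "column k X \<in> columns X" by (auto simp: columns_def)
    then show ?thesis using * span_base unfolding col_space_def null_space_def by blast
  qed
  then have "(\<Sum>j\<in>UNIV. Y $ i $ j * X $ j $ k) = 0" for i k
    by (auto simp: matrix_vector_mult_def column_def vec_eq_iff)
  then have "(\<Sum>j\<in>UNIV. Y $ i $ j * X $ i $ j) = 0" for i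
    using symmetric_matrix_entry[of X i] assms(1) by (simp add: psd_def)
  then show "Y \<bullet> X = 0"
    by (simp add: inner_vec_def)
qed

lemma psd_norm_le_trace:
  assumes "psd X"
  shows "norm X \<le> trace X"
  using assms
proof (induction X rule: psd_induct)
  case (add_outer X v)
  then show ?case
    using norm_triangle_ineq[of X "outer v"] by (simp add: trace_add norm_outer trace_outer)
qed (simp add: trace_def)

lemma pos_def_imp_psd: "pos_def M \<Longrightarrow> psd M"
  unfolding pos_def_def psd_def by (metis inner_zero_left less_eq_real_def)

lemma pos_def_inner_eq_0:
  assumes "pos_def S" "psd X" "S \<bullet> X = 0"
  shows "X = 0"
proof -
  have "S *v (X *v u) = 0" for u
    by (rule psd_inner_eq_0_mult_vec) (use assms pos_def_imp_psd in auto)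
  then have "X *v u = 0" for u
    using assms(1) unfolding pos_def_def by (metis inner_zero_right less_irrefl)
  then show ?thesis by (simp add: matrix_eq)
qed

text \<open>For fixed \<open>v\<close> the quadratic form is linear in the matrix, so the set is an
  intersection of hyperplanes and closed half-spaces.\<close>

lemma closed_psd: "closed {X :: real^'n^'n. psd X}"
proof -
  have "transpose X = X \<longleftrightarrow> (\<forall>i j. X $ j $ i = X $ i $ j)" for X :: "real^'n^'n"
    by (simp add: transpose_def vec_eq_iff)
  then have "{X :: real^'n^'n. psd X} =
      (\<Inter>i. \<Inter>j. {X. X $ j $ i = X $ i $ j}) \<inter> (\<Inter>v. {X. 0 \<le> X \<bullet> outer v})"
    by (simp only: psd_def inner_outer set_eq_iff INT_iff Int_iff mem_Collect_eq) blast
  then show ?thesis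
    by (simp only:)
      (intro closed_Int closed_INT ballI closed_Collect_eq closed_Collect_le continuous_intros)
qed

lemma convex_cone_psd: "convex_cone {X. psd X}"
  by (auto simp: convex_cone_iff psd_0 psd_add psd_scaleR)

section \<open>Nonnegative integer combinations\<close>

text \<open>For finite \<open>S\<close> this is the additive submonoid generated by
  \<open>S\<close>. It covers both the matrix combinations of \<open>property_PZ\<close> and the
  vector combinations of \<open>hilbert_basis\<close>.\<close>

definition nat_cone :: "'a::real_vector set \<Rightarrow> 'a set" where
  "nat_cone S = {x. \<exists>y :: 'a \<Rightarrow> nat. x = (\<Sum>v\<in>S. real (y v) *\<^sub>R v)}"

lemma nat_coneI: "(\<Sum>v\<in>S. real (y v) *\<^sub>R v) \<in> nat_cone S"
  unfolding nat_cone_def by blast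

lemma nat_cone_0: "0 \<in> nat_cone S"
  unfolding nat_cone_def by (auto intro!: exI[of _ "\<lambda>_. 0"])

lemma nat_cone_add:
  assumes "x \<in> nat_cone S" "y \<in> nat_cone S"
  shows "x + y \<in> nat_cone S"
proof -
  obtain a b :: "'a \<Rightarrow> nat" where
    "x = (\<Sum>v\<in>S. real (a v) *\<^sub>R v)" "y = (\<Sum>v\<in>S. real (b v) *\<^sub>R v)"
    using assms unfolding nat_cone_def by blast
  then have "x + y = (\<Sum>v\<in>S. real (a v + b v) *\<^sub>R v)"
    by (simp add: sum.distrib scaleR_left_distrib)
  then show ?thesis by (simp only: nat_coneI[of "\<lambda>v. a v + b v"])
qed

lemma nat_cone_base:
  assumes "finite S" "v \<in> S"
  shows "v \<in> nat_cone S"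
proof -
  have "(\<Sum>w\<in>S. real (if w = v then 1 else 0) *\<^sub>R w) = v"
    using assms by (simp add: if_distrib [of real] if_distrib [of "\<lambda>c. c *\<^sub>R _"] cong: if_cong)
  then show ?thesis using nat_coneI[of "\<lambda>w. if w = v then 1 else 0" S] by simp
qed

lemma nat_cone_minimal:
  assumes "S \<subseteq> M" "0 \<in> M" and add: "\<And>x y. x \<in> M \<Longrightarrow> y \<in> M \<Longrightarrow> x + y \<in> M"
  shows "nat_cone S \<subseteq> M"
proof -
  have "real n *\<^sub>R v \<in> M" if "v \<in> M" for n v
    by (induction n) (use that assms(2) add in \<open>auto simp: scaleR_left_distrib\<close>)
  then have "(\<Sum>v\<in>F. real (y v) *\<^sub>R v) \<in> M" if "F \<subseteq> S" for F and y :: "'a \<Rightarrow> nat"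
    using that assms by (induction F rule: infinite_finite_induct) auto
  then show ?thesis unfolding nat_cone_def by blast
qed

lemma nat_cone_mono: "finite T \<Longrightarrow> S \<subseteq> T \<Longrightarrow> nat_cone S \<subseteq> nat_cone T"
  by (intro nat_cone_minimal) (auto intro: nat_cone_base nat_cone_0 nat_cone_add)

text \<open>\<open>f\<close> may identify elements of \<open>S\<close>, so coefficients do not
  correspond one to one. Minimality of the generated submonoid, applied in both directions, avoids
  choosing preimages.\<close>

lemma nat_cone_linear_image:
  assumes "finite S" "linear f"
  shows "nat_cone (f ` S) = f ` nat_cone S"
proof
  interpret linear f by fact
  show "nat_cone (f ` S) \<subseteq> f ` nat_cone S"
  proof (rule nat_cone_minimal)
    show "f ` S \<subseteq> f ` nat_cone S" using nat_cone_base[OF assms(1)] by blast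
    show "0 \<in> f ` nat_cone S" using nat_cone_0 zero by (metis image_eqI)
    fix x y assume "x \<in> f ` nat_cone S" "y \<in> f ` nat_cone S"
    then obtain a b where "a \<in> nat_cone S" "b \<in> nat_cone S" "x = f a" "y = f b" by blast
    then show "x + y \<in> f ` nat_cone S"
      using nat_cone_add[of a S b] by (metis add image_eqI)
  qed
  have "nat_cone S \<subseteq> f -` nat_cone (f ` S)"
    using assms(1)
    by (intro nat_cone_minimal) (auto simp: zero add nat_cone_0 nat_cone_add nat_cone_base)
  then show "f ` nat_cone S \<subseteq> nat_cone (f ` S)" by blast
qed

section \<open>Dickson's lemma and finitely generated submonoids\<close>

lemma nat_seq_incseq_subseq:
  fixes s :: "nat \<Rightarrow> nat"
  obtains r where "strict_mono r" "incseq (\<lambda>n. s (r n))"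
proof -
  obtain r where r: "strict_mono r" "monoseq (\<lambda>n. s (r n))"
    using seq_monosub by blast
  show thesis
  proof (cases "incseq (\<lambda>n. s (r n))")
    case True
    then show ?thesis using r that by blast
  next
    case False
    then have dec: "decseq (\<lambda>n. s (r n))" using r by (simp add: monoseq_iff)
    \<comment> \<open>A decreasing sequence of naturals is constant once it has reached its least
      value, hence also increasing from there on.\<close>
    obtain N where N: "\<And>n. s (r N) \<le> s (r n)"
      using ex_has_least_nat[of "\<lambda>_. True" 0 "\<lambda>n. s (r n)"] by blast
    have "s (r (N + n)) \<le> s (r N)" for n
      using decseqD[OF dec, of N "N + n"] by simp
    then have "s (r (N + n)) = s (r N)" for n using N by (simp add: order_antisym)
    then have "incseq (\<lambda>n. s (r (N + n)))" by (simp add: incseq_def)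
    moreover have "strict_mono (\<lambda>n. r (N + n))" using r(1) by (simp add: strict_mono_def)
    ultimately show ?thesis using that by blast
  qed
qed

text \<open>Subsequences are extracted one coordinate at a time; monotonicity already achieved
  survives further thinning.\<close>

lemma Dickson_subseq:
  fixes f :: "nat \<Rightarrow> 'a \<Rightarrow> nat"
  assumes "finite S"
  shows "\<exists>r. strict_mono r \<and> (\<forall>v\<in>S. incseq (\<lambda>n. f (r n) v))"
  using assms
proof (induction S rule: finite_induct)
  case empty
  then show ?case by (auto intro: exI[of _ id] simp: strict_mono_id)
next
  case (insert w S)
  then obtain r where r: "strict_mono r" "\<forall>v\<in>S. incseq (\<lambda>n. f (r n) v)" by blast
  obtain q where q: "strict_mono q" "incseq (\<lambda>n. f (r (q n)) w)"
    using nat_seq_incseq_subseq[of "\<lambda>n. f (r n) w"] .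
  have "incseq (\<lambda>n. f (r (q n)) v)" if "v \<in> S" for v
    using r(2) that q(1) by (auto simp: incseq_def strict_mono_less_eq)
  then show ?case
    using q r(1) by (auto intro!: exI[of _ "\<lambda>n. r (q n)"] simp: strict_mono_def)
qed

text \<open>An injective sequence in an infinite \<open>M\<close> would have a subsequence
  increasing in every coordinate, and thus two distinct comparable members.\<close>

lemma finite_antichain_nat_functions:
  fixes M :: "('a \<Rightarrow> nat) set"
  assumes "finite S" and supp: "\<And>y v. y \<in> M \<Longrightarrow> v \<notin> S \<Longrightarrow> y v = 0"
    and anti: "\<And>y z. y \<in> M \<Longrightarrow> z \<in> M \<Longrightarrow> y \<le> z \<Longrightarrow> y = z"
  shows "finite M"
proof (rule ccontr)
  assume "infinite M"
  then obtain f :: "nat \<Rightarrow> 'a \<Rightarrow> nat" where f: "inj f" "range f \<subseteq> M"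
    using infinite_countable_subset by blast
  obtain r where r: "strict_mono r" "\<forall>v\<in>S. incseq (\<lambda>n. f (r n) v)"
    using Dickson_subseq[OF assms(1)] by blast
  have "f (r 0) v \<le> f (r 1) v" for v
    using r(2) supp[OF subsetD[OF f(2) rangeI], of v "r 0"]
    by (cases "v \<in> S") (auto simp: incseq_def)
  then have "f (r 0) = f (r 1)" using f(2) by (intro anti) (auto simp: le_fun_def)
  then show False using f(1) r(1) by (metis injD strict_mono_eq zero_neq_one)
qed

text \<open>The minimal nonzero coefficient functions with value in \<open>G\<close> form an
  antichain, hence a finite set. Subtracting a minimal one below a given function keeps the value in
  \<open>G\<close> and lowers the coefficient sum, so the minimal ones generate.\<close>

lemma nat_cone_Int_subgroup_finitely_generated:
  fixes S :: "'a::real_vector set"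
  assumes "finite S" and diff: "\<And>x y. x \<in> G \<Longrightarrow> y \<in> G \<Longrightarrow> x - y \<in> G"
  obtains T where "finite T" "T \<subseteq> nat_cone S \<inter> G" "nat_cone S \<inter> G \<subseteq> nat_cone T"
proof -
  define ev :: "('a \<Rightarrow> nat) \<Rightarrow> 'a" where "ev y = (\<Sum>v\<in>S. real (y v) *\<^sub>R v)" for y
  define L where "L = {y. (\<forall>v. v \<notin> S \<longrightarrow> y v = 0) \<and> ev y \<in> G \<and> y \<noteq> (\<lambda>_. 0)}"
  define M where "M = {y \<in> L. \<forall>z\<in>L. z \<le> y \<longrightarrow> z = y}"
  have "finite M"
    by (rule finite_antichain_nat_functions[OF assms(1)]) (auto simp: M_def L_def)
  then have fin: "finite (ev ` M)" by simp
  have gen: "ev y \<in> nat_cone (ev ` M)" if "\<forall>v. v \<notin> S \<longrightarrow> y v = 0" "ev y \<in> G" for y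
    using that
  proof (induction "\<Sum>v\<in>S. y v" arbitrary: y rule: less_induct)
    case less
    show ?case
    proof (cases "y = (\<lambda>_. 0)")
      case True
      then show ?thesis by (simp add: ev_def nat_cone_0)
    next
      case False
      then have "y \<in> L \<and> y \<le> y" using less.prems by (simp add: L_def)
      \<comment> \<open>A member of \<open>L\<close> below \<open>y\<close> with least coefficient
        sum is minimal in \<open>L\<close>.\<close>
      then obtain z where z: "z \<in> L" "z \<le> y"
        and least: "\<And>w. w \<in> L \<and> w \<le> y \<Longrightarrow> (\<Sum>v\<in>S. z v) \<le> (\<Sum>v\<in>S. w v)"
        using ex_has_least_nat[of "\<lambda>w. w \<in> L \<and> w \<le> y" y "\<lambda>w. \<Sum>v\<in>S. w v"] by blast
      have "w = z" if "w \<in> L" "w \<le> z" for w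
      proof (rule ccontr)
        assume "w \<noteq> z"
        then obtain v where v: "w v \<noteq> z v" by blast
        then have "v \<in> S" "w v < z v"
          using that z(1) by (auto simp: L_def le_fun_def order_less_le)
        then have "(\<Sum>v\<in>S. w v) < (\<Sum>v\<in>S. z v)"
          using that(2) assms(1) by (intro sum_strict_mono_ex1) (auto simp: le_fun_def)
        moreover have "w \<le> y" using that(2) z(2) by (rule order_trans)
        ultimately show False using least[of w] that(1) by simp
      qed
      then have "z \<in> M" using z(1) by (simp add: M_def)
      then have zT: "ev z \<in> nat_cone (ev ` M)" using fin by (intro nat_cone_base) auto
      let ?w = "\<lambda>v. y v - z v"
      have "z \<noteq> (\<lambda>_. 0)" "\<forall>v. v \<notin> S \<longrightarrow> z v = 0" using z(1) by (auto simp: L_def)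
      then obtain v where v: "v \<in> S" "0 < z v" by fastforce
      have zy: "z v \<le> y v" for v using z(2) by (simp add: le_fun_def)
      have "(\<Sum>v\<in>S. ?w v) < (\<Sum>v\<in>S. y v)"
        using v zy[of v] assms(1)
        by (intro sum_strict_mono_ex1 bexI[of _ v]) (auto intro: diff_less)
      moreover have ev: "ev ?w = ev y - ev z"
        using zy by (simp add: ev_def of_nat_diff scaleR_left_diff_distrib sum_subtractf)
      moreover have "ev ?w \<in> G" using ev less.prems z(1) diff by (simp add: L_def)
      ultimately have "ev ?w \<in> nat_cone (ev ` M)"
        using less.hyps[of ?w] less.prems by simp
      from nat_cone_add[OF this zT] show ?thesis by (simp add: ev)
    qed
  qed
  show thesis
  proof (rule that[OF fin])
    show "ev ` M \<subseteq> nat_cone S \<inter> G"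
      by (auto simp: M_def L_def nat_cone_def ev_def)
    show "nat_cone S \<inter> G \<subseteq> nat_cone (ev ` M)"
    proof
      fix x assume x: "x \<in> nat_cone S \<inter> G"
      then obtain y :: "'a \<Rightarrow> nat" where y: "x = ev y" by (auto simp: nat_cone_def ev_def)
      define y' where "y' v = (if v \<in> S then y v else 0)" for v
      have "ev y' = x" unfolding y ev_def y'_def by (intro sum.cong) auto
      then show "x \<in> nat_cone (ev ` M)" using gen[of y'] x by (auto simp: y'_def)
    qed
  qed
qed

lemma psd_nat_cone:
  assumes "\<forall>V\<in>\<V>. psd V" "X \<in> nat_cone \<V>"
  shows "psd X"
proof -
  have "nat_cone \<V> \<subseteq> {X. psd X}"
    using assms(1) by (intro nat_cone_minimal) (auto simp: psd_0 psd_add)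
  then show ?thesis using assms(2) by blast
qed

lemma property_PZ_iff: "property_PZ \<V> X \<longleftrightarrow> psd X \<and> X \<in> nat_cone \<V>"
  by (simp add: property_PZ_def nat_cone_def)

section \<open>Normal cones\<close>

lemma bounded_ray_direction_eq_0:
  fixes x d :: "'a::real_normed_vector"
  assumes "bounded S" and ray: "\<And>s. 0 \<le> s \<Longrightarrow> x + s *\<^sub>R d \<in> S"
  shows "d = 0"
proof (rule ccontr)
  assume "d \<noteq> 0"
  obtain R where R: "\<And>y. y \<in> S \<Longrightarrow> norm y \<le> R"
    using assms(1) unfolding bounded_iff by blast
  \<comment> \<open>Makes \<open>s *\<^sub>R d\<close> longer than the bound
    \<open>R + norm x\<close> by exactly one.\<close>
  define s where "s = (R + norm x + 1) / norm d"
  have "0 \<le> R" using order_trans[OF norm_ge_zero R[OF ray[of 0]]] by simp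
  then have s: "0 \<le> s" by (simp add: s_def)
  have "norm (s *\<^sub>R d) \<le> norm (x + s *\<^sub>R d) + norm x"
    using norm_triangle_ineq4[of "x + s *\<^sub>R d" x] by simp
  moreover have "norm (s *\<^sub>R d) = R + norm x + 1"
    using \<open>d \<noteq> 0\<close> \<open>0 \<le> R\<close> by (simp add: s_def)
  ultimately show False using R[OF ray[OF s]] by simp
qed

lemma normal_cone_attained:
  assumes "compact P" "P \<noteq> {}"
  obtains x where "b \<in> normal_cone P x"
proof -
  have "continuous_on P (\<lambda>x. b \<bullet> x)" by (intro continuous_intros)
  from continuous_attains_sup[OF assms this] show thesis
    using that unfolding normal_cone_def by blast
qed

lemma convex_cone_normal_cone:
  assumes "x \<in> P"
  shows "convex_cone (normal_cone P x)"
  using assms by (auto simp: convex_cone_iff normal_cone_def inner_left_distrib add_mono mult_left_mono)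

text \<open>The maximizers of \<open>b\<close> form a nonempty compact face; by Krein-Milman it has
  an extreme point, which is also extreme in \<open>P\<close>.\<close>

lemma extreme_point_normal_cone:
  fixes P :: "(real^'m) set"
  assumes "compact P" "convex P" "P \<noteq> {}"
  obtains x where "x extreme_point_of P" "b \<in> normal_cone P x"
proof -
  obtain x0 where x0: "b \<in> normal_cone P x0"
    using normal_cone_attained[OF assms(1,3)] .
  define F where "F = P \<inter> {x. b \<bullet> x = b \<bullet> x0}"
  have face: "F face_of P"
    unfolding F_def using x0 assms(2)
    by (intro face_of_Int_supporting_hyperplane_le) (auto simp: normal_cone_def)
  have "compact F" "convex F"
    using face assms face_of_imp_compact face_of_imp_convex by blast+
  moreover have "x0 \<in> F" using x0 by (simp add: F_def normal_cone_def)
  ultimately have "{x. x extreme_point_of F} \<noteq> {}"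
    using Krein_Milman_Minkowski by (metis convex_hull_empty empty_iff)
  then obtain x where "x extreme_point_of F" by blast
  then have "x extreme_point_of P" "x \<in> F"
    using extreme_point_of_face[OF face] by auto
  then show thesis
    using that x0 by (auto simp: F_def normal_cone_def)
qed

lemma scaled_floor_tendsto:
  fixes b :: "real^'m"
  shows "(\<lambda>n. (\<chi> i. of_int \<lfloor>real (Suc n) * b $ i\<rfloor> / real (Suc n))) \<longlonglongrightarrow> b"
proof (rule vec_tendstoI, simp only: vec_lambda_beta)
  fix i
  let ?t = "b $ i"
  have lo: "?t - 1 / real (Suc n) \<le> of_int \<lfloor>real (Suc n) * ?t\<rfloor> / real (Suc n)"
    and hi: "of_int \<lfloor>real (Suc n) * ?t\<rfloor> / real (Suc n) \<le> ?t" for n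
  proof -
    let ?k = "real (Suc n)"
    have "(?k * ?t - 1) / ?k \<le> of_int \<lfloor>?k * ?t\<rfloor> / ?k" "of_int \<lfloor>?k * ?t\<rfloor> / ?k \<le> ?k * ?t / ?k"
      by (intro divide_right_mono; linarith)+
    then show "?t - 1 / ?k \<le> of_int \<lfloor>?k * ?t\<rfloor> / ?k" "of_int \<lfloor>?k * ?t\<rfloor> / ?k \<le> ?t"
      by (simp_all add: diff_divide_distrib)
  qed
  have "(\<lambda>n. ?t - 1 / real (Suc n)) \<longlonglongrightarrow> ?t"
    using tendsto_diff[OF tendsto_const LIMSEQ_inverse_real_of_nat, of ?t]
    by (simp add: inverse_eq_divide)
  then show "(\<lambda>n. of_int \<lfloor>real (Suc n) * ?t\<rfloor> / real (Suc n)) \<longlonglongrightarrow> ?t"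
    by (rule tendsto_sandwich[OF _ _ _ tendsto_const, rotated 2])
      (use lo hi in \<open>auto intro!: always_eventually\<close>)
qed

text \<open>Scaling carries the claim from integral to rational \<open>b\<close>, and closedness of
  \<open>D\<close> carries it to the limit. The optimal values converge: the fixed \<open>x\<close>
  bounds them from below, and a norm bound on \<open>P\<close> bounds them from above.\<close>

lemma support_graph_in_closed_cone:
  fixes P :: "(real^'m) set" and D :: "((real^'m) \<times> real) set"
  assumes P: "compact P" and D: "closed D" "conic D"
    and int: "\<And>b x. b \<in> int_vecs \<Longrightarrow> b \<in> normal_cone P x \<Longrightarrow> (b, b \<bullet> x) \<in> D"
    and b: "b \<in> normal_cone P x"
  shows "(b, b \<bullet> x) \<in> D"
proof -
  define c where "c n = (\<chi> i. of_int \<lfloor>real (Suc n) * b $ i\<rfloor> / real (Suc n))" for n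
  have lim: "c \<longlonglongrightarrow> b" unfolding c_def by (rule scaled_floor_tendsto)
  have x: "x \<in> P" using b by (simp add: normal_cone_def)
  have "\<exists>y. c n \<in> normal_cone P y" for n
    using normal_cone_attained[OF P, of "c n"] x by blast
  then obtain y where y: "c n \<in> normal_cone P (y n)" for n by metis
  have mem: "(c n, c n \<bullet> y n) \<in> D" for n
  proof -
    let ?k = "real (Suc n)"
    have "?k *\<^sub>R c n \<in> int_vecs" by (simp add: c_def int_vecs_def)
    moreover have "?k *\<^sub>R c n \<in> normal_cone P (y n)"
      using y[of n] by (auto simp: normal_cone_def mult_left_mono)
    ultimately have "(?k *\<^sub>R c n, (?k *\<^sub>R c n) \<bullet> y n) \<in> D" by (rule int)
    then have "(1 / ?k) *\<^sub>R (?k *\<^sub>R c n, (?k *\<^sub>R c n) \<bullet> y n) \<in> D"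
      using D(2) by (intro conicD) auto
    then show ?thesis by simp
  qed
  obtain R where R: "\<And>z. z \<in> P \<Longrightarrow> norm z \<le> R"
    using compact_imp_bounded[OF P] unfolding bounded_iff by blast
  have lo: "c n \<bullet> x \<le> c n \<bullet> y n" for n
    using y[of n] x by (simp add: normal_cone_def)
  have hi: "c n \<bullet> y n \<le> b \<bullet> x + norm (c n - b) * R" for n
  proof -
    have yP: "y n \<in> P" using y[of n] by (simp add: normal_cone_def)
    have "c n \<bullet> y n = b \<bullet> y n + (c n - b) \<bullet> y n" by (simp add: inner_diff_left)
    also have "\<dots> \<le> b \<bullet> x + norm (c n - b) * norm (y n)"
      using b yP by (intro add_mono norm_cauchy_schwarz) (simp add: normal_cone_def)
    also have "\<dots> \<le> b \<bullet> x + norm (c n - b) * R"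
      using R[OF yP] by (simp add: mult_left_mono)
    finally show ?thesis .
  qed
  have "(\<lambda>n. c n \<bullet> x) \<longlonglongrightarrow> b \<bullet> x" by (intro tendsto_intros lim)
  moreover have "(\<lambda>n. b \<bullet> x + norm (c n - b) * R) \<longlonglongrightarrow> b \<bullet> x + norm (b - b) * R"
    by (intro tendsto_intros lim)
  ultimately have "(\<lambda>n. c n \<bullet> y n) \<longlonglongrightarrow> b \<bullet> x"
    by (intro tendsto_sandwich[of "\<lambda>n. c n \<bullet> x" "\<lambda>n. c n \<bullet> y n" sequentially
          "\<lambda>n. b \<bullet> x + norm (c n - b) * R"]) (use lo hi in auto)
  then have "(\<lambda>n. (c n, c n \<bullet> y n)) \<longlonglongrightarrow> (b, b \<bullet> x)" by (intro tendsto_Pair lim)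
  then show ?thesis using closed_sequentially[OF D(1), of "\<lambda>n. (c n, c n \<bullet> y n)"] mem by blast
qed

section \<open>Semidefinite duality\<close>

lemma linear_constraint_vec: "linear (constraint_vec A)"
  by (auto intro!: linearI simp: constraint_vec_def trace_inner_eq vec_eq_iff inner_right_distrib)

lemma linear_dual_map: "linear (\<lambda>X. (constraint_vec A X, C \<bullet> X))"
  using linear_constraint_vec[of A]
  by (auto intro!: linearI simp: linear_add linear_cmul inner_right_distrib)

lemma inner_constraint_vec: "u \<bullet> constraint_vec A X = (\<Sum>i\<in>UNIV. u $ i *\<^sub>R A i) \<bullet> X"
  by (simp add: inner_vec_def[of u] constraint_vec_def trace_inner_eq inner_sum_left)

text \<open>The duality gap of \<open>x\<close> and \<open>X\<close>: weak duality is its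
  nonnegativity, complementary slackness its vanishing.\<close>

lemma inner_slack: "slack C A x \<bullet> X = C \<bullet> X - constraint_vec A X \<bullet> x"
  by (simp add: slack_def inner_diff_left inner_constraint_vec inner_commute[of _ x])

lemma dual_feasible_iff: "dual_feasible A b X \<longleftrightarrow> psd X \<and> constraint_vec A X = b"
  by (auto simp: dual_feasible_def constraint_vec_def vec_eq_iff)

lemma weak_duality:
  assumes "x \<in> lmi_solutions C A" "psd X"
  shows "constraint_vec A X \<bullet> x \<le> C \<bullet> X"
proof -
  have "0 \<le> slack C A x \<bullet> X"
    using assms by (intro psd_inner_nonneg) (simp_all add: lmi_solutions_def)
  then show ?thesis by (simp add: inner_slack)
qed

section \<open>Strong duality under boundedness and Slater's condition\<close>

locale bounded_slater_lmi =
  fixes C :: "real^'n^'n" and A :: "'m::finite \<Rightarrow> real^'n^'n"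
  assumes sym_C: "transpose C = C" and sym_A: "\<And>i. transpose (A i) = A i"
    and bounded: "bounded (lmi_solutions C A)"
    and slater: "slater C A"
begin

abbreviation "P \<equiv> lmi_solutions C A"

lemma symmetric_pencil:
  "transpose ((\<Sum>i\<in>UNIV. u $ i *\<^sub>R A i) + t *\<^sub>R C) = (\<Sum>i\<in>UNIV. u $ i *\<^sub>R A i) + t *\<^sub>R C"
proof -
  have "C $ j $ i = C $ i $ j" "A k $ j $ i = A k $ i $ j" for i j k
    using symmetric_matrix_entry sym_C sym_A by blast+
  then show ?thesis by (simp add: transpose_def vec_eq_iff)
qed

lemma psd_pencil_iff:
  "psd ((\<Sum>i\<in>UNIV. u $ i *\<^sub>R A i) + t *\<^sub>R C) \<longleftrightarrow>
     (\<forall>v. 0 \<le> ((\<Sum>i\<in>UNIV. u $ i *\<^sub>R A i) + t *\<^sub>R C) \<bullet> outer v)"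
  using symmetric_pencil by (simp add: psd_def inner_outer)

lemma slack_eq_pencil: "slack C A x = (\<Sum>i\<in>UNIV. (- x) $ i *\<^sub>R A i) + 1 *\<^sub>R C"
  by (simp add: slack_def sum_negf)

lemma lmi_solutions_eq: "P = (\<Inter>v. {x. constraint_vec A (outer v) \<bullet> x \<le> C \<bullet> outer v})"
proof -
  have "psd (slack C A x) \<longleftrightarrow> (\<forall>v. 0 \<le> slack C A x \<bullet> outer v)" for x
    unfolding slack_eq_pencil by (rule psd_pencil_iff)
  then show ?thesis by (auto simp: lmi_solutions_def inner_slack)
qed

lemma compact_lmi: "compact P"
proof -
  have "closed P" unfolding lmi_solutions_eq by (intro closed_INT ballI closed_halfspace_le)
  then show ?thesis using bounded by (simp add: compact_eq_bounded_closed)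
qed

lemma convex_lmi: "convex P"
  unfolding lmi_solutions_eq by (intro convex_INT convex_halfspace_le)

lemma nonempty_lmi: "P \<noteq> {}"
  using slater pos_def_imp_psd unfolding slater_def lmi_solutions_def by blast

text \<open>The cone is generated by the image of the compact trace-one slice \<open>B\<close>. A
  positive definite slack matrix keeps this image away from 0, and the conic hull of a compact set
  avoiding 0 is closed.\<close>

lemma closed_dual_image: "closed ((\<lambda>X. (constraint_vec A X, C \<bullet> X)) ` {X. psd X})"
proof -
  let ?f = "\<lambda>X. (constraint_vec A X, C \<bullet> X)"
  define B where "B = {X :: real^'n^'n. psd X \<and> trace X = 1}"
  have lin: "linear ?f" by (rule linear_dual_map)
  have tr: "trace X = mat 1 \<bullet> X" for X :: "real^'n^'n"
    by (simp flip: trace_inner_eq add: trace_inner_def)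
  have "B = {X. psd X} \<inter> {X. mat 1 \<bullet> X = 1}" by (auto simp: B_def tr)
  then have "closed B"
    by (simp add: closed_Int closed_psd closed_hyperplane)
  moreover have "bounded B"
    using psd_norm_le_trace unfolding bounded_iff B_def by fastforce
  ultimately have "compact (?f ` B)"
    using lin by (intro compact_continuous_image linear_continuous_on)
      (auto simp: compact_eq_bounded_closed linear_linear)
  moreover have "0 \<notin> ?f ` B"
  proof
    assume "0 \<in> ?f ` B"
    then obtain X where X: "psd X" "trace X = 1" "constraint_vec A X = 0" "C \<bullet> X = 0"
      by (auto simp: B_def zero_prod_def)
    obtain x where "pos_def (slack C A x)" using slater unfolding slater_def by blast
    then have "X = 0" using X by (auto intro: pos_def_inner_eq_0 simp: inner_slack)
    then show False using X(2) by (simp add: trace_def)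
  qed
  ultimately have "closed (conic hull (?f ` B))" by (intro closed_conic_hull) blast
  moreover have "conic hull (?f ` B) = ?f ` {X. psd X}"
  proof -
    have "conic hull B = {X. psd X}"
    proof
      show "conic hull B \<subseteq> {X. psd X}" by (auto simp: conic_hull_explicit B_def psd_scaleR)
      show "{X. psd X} \<subseteq> conic hull B"
      proof clarify
        fix X :: "real^'n^'n" assume X: "psd X"
        show "X \<in> conic hull B"
        proof (cases "X = 0")
          case True
          \<comment> \<open>The conic hull contains 0 as soon as \<open>B\<close> is nonempty; a
            scaled identity matrix is a member.\<close>
          have "psd (mat 1 :: real^'n^'n)" by (simp add: psd_def)
          then have "psd ((1 / real CARD('n)) *\<^sub>R mat 1 :: real^'n^'n)" by (simp add: psd_scaleR)
          then have "(1 / real CARD('n)) *\<^sub>R mat 1 \<in> B"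
            by (simp add: B_def tr inner_vec_def mat_def if_distrib [of "\<lambda>x. x * _"] cong: if_cong)
          then show ?thesis using True by (metis conic_hull_contains_0 empty_iff)
        next
          case False
          then have pos: "0 < trace X" using psd_norm_le_trace[OF X] by (smt (verit) zero_less_norm_iff)
          then have "(1 / trace X) *\<^sub>R X \<in> B"
            using X by (simp add: B_def psd_scaleR tr)
          moreover have "X = trace X *\<^sub>R ((1 / trace X) *\<^sub>R X)" using pos by simp
          ultimately show ?thesis using pos unfolding conic_hull_explicit by (metis (mono_tags, lifting) mem_Collect_eq less_imp_le)
        qed
      qed
    qed
    then show ?thesis using conic_hull_linear_image[OF lin, of B] by simp
  qed
  ultimately show ?thesis by simp
qed

text \<open>Otherwise a functional \<open>(u, t)\<close> strictly separates the point from the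
  closed lifted cone, and its pencil \<open>N\<close> is positive semidefinite. For positive
  \<open>t\<close> this yields a feasible point better than \<open>x\<close>; for other
  \<open>t\<close> it yields a ray in \<open>P\<close>.\<close>

lemma strong_duality:
  assumes b: "b \<in> normal_cone P x"
  obtains X where "psd X" "constraint_vec A X = b" "C \<bullet> X = b \<bullet> x"
proof (rule ccontr)
  let ?T = "(\<lambda>X. (constraint_vec A X, C \<bullet> X)) ` {X. psd X}"
  assume "\<not> thesis"
  then have notin: "(b, b \<bullet> x) \<notin> ?T"
    using that unfolding image_iff by force
  have T: "convex_cone ?T" using convex_cone_linear_image[of "{X. psd X}"] convex_cone_psd linear_dual_map by blast
  then have "convex ?T" by (simp add: convex_cone_def)
  then obtain a \<beta> where a: "a \<bullet> (b, b \<bullet> x) < \<beta>" "\<And>z. z \<in> ?T \<Longrightarrow> \<beta> < a \<bullet> z"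
    using separating_hyperplane_closed_point[OF _ closed_dual_image notin] by blast
  have neg: "\<beta> < 0" using a(2)[OF convex_cone_contains_0[OF T]] by simp
  have nonneg: "0 \<le> a \<bullet> z" if "z \<in> ?T" for z
  proof (rule ccontr)
    assume "\<not> 0 \<le> a \<bullet> z"
    \<comment> \<open>The rescaled point stays in the cone, but the functional takes exactly the
      value \<open>\<beta>\<close> there, against strict separation.\<close>
    then have "(\<beta> / (a \<bullet> z)) *\<^sub>R z \<in> ?T"
      using neg that by (intro convex_cone_scaleR[OF T]) (simp_all add: divide_nonpos_neg)
    from a(2)[OF this] show False using \<open>\<not> 0 \<le> a \<bullet> z\<close> by simp
  qed
  obtain u t where ut: "a = (u, t)" by (cases a)
  define N where "N = (\<Sum>i\<in>UNIV. u $ i *\<^sub>R A i) + t *\<^sub>R C"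
  have NX: "N \<bullet> X = a \<bullet> (constraint_vec A X, C \<bullet> X)" for X
    by (simp add: N_def ut inner_add_left inner_constraint_vec)
  have N: "psd N" unfolding N_def psd_pencil_iff
    unfolding N_def[symmetric] NX by (intro allI nonneg) (auto simp: psd_outer)
  have sep: "u \<bullet> b + t * (b \<bullet> x) < 0" using a(1) neg by (simp add: ut)
  show False
  proof (cases "0 < t")
    case True
    have "slack C A (- (1 / t) *\<^sub>R u) = (1 / t) *\<^sub>R N"
      using True by (simp add: slack_def N_def sum_negf scaleR_right_distrib scaleR_sum_right)
    then have "- (1 / t) *\<^sub>R u \<in> P" using N True by (simp add: lmi_solutions_def psd_scaleR)
    then have "b \<bullet> (- (1 / t) *\<^sub>R u) \<le> b \<bullet> x" using b unfolding normal_cone_def by blast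
    then show False using sep True by (simp add: field_simps inner_commute)
  next
    case False
    obtain x0 where x0: "pos_def (slack C A x0)" using slater unfolding slater_def by blast
    \<comment> \<open>Along \<open>d\<close> from \<open>x0\<close> the slack is
      \<open>(1 - s * t) *\<^sub>R slack C A x0 + s *\<^sub>R N\<close>, which stays positive
      semidefinite because \<open>t \<le> 0\<close>. Boundedness then forces
      \<open>d = 0\<close>.\<close>
    define d where "d = - t *\<^sub>R x0 - u"
    have Ad: "(\<Sum>i\<in>UNIV. d $ i *\<^sub>R A i) = t *\<^sub>R slack C A x0 - N"
      by (simp add: d_def slack_def N_def scaleR_left_diff_distrib sum_subtractf sum_negf
          scaleR_sum_right scaleR_right_diff_distrib)
    have "slack C A (x0 + s *\<^sub>R d) = (1 - s * t) *\<^sub>R slack C A x0 + s *\<^sub>R N" for s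
    proof -
      have "slack C A (x0 + s *\<^sub>R d) = slack C A x0 - s *\<^sub>R (\<Sum>i\<in>UNIV. d $ i *\<^sub>R A i)"
        by (simp add: slack_def scaleR_left_distrib sum.distrib scaleR_sum_right)
      then show ?thesis unfolding Ad by (simp add: algebra_simps)
    qed
    moreover have "0 \<le> 1 - s * t" if "0 \<le> s" for s
      using that False mult_nonneg_nonpos[of s t] by simp
    ultimately have "x0 + s *\<^sub>R d \<in> P" if "0 \<le> s" for s
      using that N pos_def_imp_psd[OF x0] by (simp add: lmi_solutions_def psd_add psd_scaleR)
    then have d0: "d = 0" using bounded_ray_direction_eq_0[OF bounded] by blast
    \<comment> \<open>Since \<open>N\<close> is positive semidefinite and the slack positive
      definite, \<open>t\<close> cannot be negative. So \<open>t\<close> and \<open>u\<close> both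
      vanish, which contradicts strict separation.\<close>
    then have "N = t *\<^sub>R slack C A x0" using Ad by simp
    moreover have "0 \<le> v \<bullet> (N *v v)" for v using N by (simp add: psd_def)
    ultimately have "0 \<le> t * (v \<bullet> (slack C A x0 *v v))" for v
      by (metis scaleR_matrix_vector_assoc inner_scaleR_right)
    moreover obtain v :: "real^'n" where "v \<noteq> 0" using vector_choose_size[of 1] by fastforce
    ultimately have "0 \<le> t" using x0 unfolding pos_def_def by (meson linorder_not_less zero_le_mult_iff)
    then have "t = 0" using False by simp
    then have "u = 0" using d0 by (simp add: d_def)
    then show False using sep \<open>t = 0\<close> by simp
  qed
qed

lemma dual_optimal_iff:
  assumes b: "b \<in> normal_cone P x"
  shows "dual_optimal C A b X \<longleftrightarrow> psd X \<and> constraint_vec A X = b \<and> slack C A x \<bullet> X = 0"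
proof -
  have x: "x \<in> P" using b by (simp add: normal_cone_def)
  have weak: "b \<bullet> x \<le> C \<bullet> Y" if "dual_feasible A b Y" for Y
    using that weak_duality[OF x] by (auto simp: dual_feasible_iff)
  obtain Y where "dual_feasible A b Y" "C \<bullet> Y = b \<bullet> x"
    using strong_duality[OF b] unfolding dual_feasible_iff by metis
  then have "dual_optimal C A b X \<longleftrightarrow> dual_feasible A b X \<and> C \<bullet> X = b \<bullet> x"
    unfolding dual_optimal_def trace_inner_eq using weak by (metis order_antisym)
  then show ?thesis by (auto simp: dual_feasible_iff inner_slack)
qed

section \<open>Hilbert bases and total dual integrality\<close>

abbreviation active :: "(real^'n^'n) set \<Rightarrow> real^'m \<Rightarrow> (real^'n^'n) set" where
  "active \<V> x \<equiv> {V \<in> \<V>. col_space V \<subseteq> null_space (slack C A x)}"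

lemma active_eq:
  assumes "\<forall>V\<in>\<V>. psd V" "x \<in> P"
  shows "active \<V> x = {V \<in> \<V>. slack C A x \<bullet> V = 0}"
  using assms psd_inner_eq_0_iff[of _ "slack C A x"] by (auto simp: lmi_solutions_def)

text \<open>The gap of \<open>X\<close> is a sum of nonnegative gaps, so every matrix with positive
  coefficient has gap zero.\<close>

lemma nat_cone_active:
  assumes "finite \<V>" "\<forall>V\<in>\<V>. psd V" "x \<in> P" "X \<in> nat_cone \<V>" "slack C A x \<bullet> X = 0"
  shows "X \<in> nat_cone (active \<V> x)"
proof -
  have S: "psd (slack C A x)" using assms(3) by (simp add: lmi_solutions_def)
  obtain y :: "real^'n^'n \<Rightarrow> nat" where y: "X = (\<Sum>V\<in>\<V>. real (y V) *\<^sub>R V)"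
    using assms(4) unfolding nat_cone_def by blast
  have nonneg: "0 \<le> real (y V) * (slack C A x \<bullet> V)" if "V \<in> \<V>" for V
    using that assms(2) S by (intro mult_nonneg_nonneg psd_inner_nonneg) auto
  have sum0: "(\<Sum>V\<in>\<V>. real (y V) * (slack C A x \<bullet> V)) = 0"
    using assms(5) by (simp add: y inner_sum_right)
  have "real (y V) * (slack C A x \<bullet> V) = 0" if "V \<in> \<V>" for V
    by (rule sum_nonneg_0[OF assms(1) nonneg sum0 that])
  then have "y V = 0" if "V \<in> \<V> - active \<V> x" for V
    using that unfolding active_eq[OF assms(2,3)] by auto
  then have "X = (\<Sum>V\<in>active \<V> x. real (y V) *\<^sub>R V)"
    unfolding y using assms(1) by (intro sum.mono_neutral_right) auto
  then show ?thesis by (simp only: nat_coneI)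
qed

lemma nat_cone_active_slack:
  assumes "\<forall>V\<in>\<V>. psd V" "x \<in> P" "X \<in> nat_cone (active \<V> x)"
  shows "slack C A x \<bullet> X = 0"
proof -
  have "nat_cone (active \<V> x) \<subseteq> {X. slack C A x \<bullet> X = 0}"
    by (intro nat_cone_minimal) (auto simp: active_eq[OF assms(1,2)] inner_right_distrib)
  then show ?thesis using assms(3) by blast
qed

text \<open>Subtracting \<open>c \<bullet> x\<close> from the objective coordinate of the lifted cone exposes the face
  generated by the active matrices.\<close>

lemma normal_cone_eq_active_hull:
  assumes fin: "finite \<V>" and psd: "\<forall>V\<in>\<V>. psd V" and x: "x \<in> P"
    and opt: "\<And>b. b \<in> int_vecs \<Longrightarrow> \<exists>X\<in>nat_cone \<V>. dual_optimal C A b X"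
  shows "convex_cone hull (constraint_vec A ` active \<V> x) = normal_cone P x"
proof
  let ?S = "constraint_vec A ` active \<V> x"
  have "?S \<subseteq> normal_cone P x"
  proof clarify
    fix V assume "V \<in> \<V>" "col_space V \<subseteq> null_space (slack C A x)"
    then have "slack C A x \<bullet> V = 0" "psd V" using active_eq[OF psd x] psd by auto
    then show "constraint_vec A V \<in> normal_cone P x"
      using weak_duality[of _ C A V] x by (auto simp: normal_cone_def inner_slack)
  qed
  then show "convex_cone hull ?S \<subseteq> normal_cone P x"
    by (intro hull_minimal convex_cone_normal_cone x)
  define D where "D = convex_cone hull ((\<lambda>V. (constraint_vec A V, C \<bullet> V)) ` \<V>)"
  have D: "closed D" "conic D" "convex_cone D"
    using fin by (auto simp: D_def closed_convex_cone_hull conic_convex_cone_hull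
        convex_cone_convex_cone_hull)
  have int: "(b, b \<bullet> y) \<in> D" if b: "b \<in> int_vecs" "b \<in> normal_cone P y" for b y
  proof -
    obtain X where X: "X \<in> nat_cone \<V>" "dual_optimal C A b X" using opt b(1) by blast
    have "nat_cone \<V> \<subseteq> {X. (constraint_vec A X, C \<bullet> X) \<in> D}"
    proof (rule nat_cone_minimal)
      show "\<V> \<subseteq> {X. (constraint_vec A X, C \<bullet> X) \<in> D}"
        unfolding D_def by (auto intro: hull_inc)
      show "0 \<in> {X. (constraint_vec A X, C \<bullet> X) \<in> D}"
        using convex_cone_contains_0[OF D(3)] linear_0[OF linear_constraint_vec[of A]]
        by (simp add: zero_prod_def)
      fix X Y assume "X \<in> {X. (constraint_vec A X, C \<bullet> X) \<in> D}"
        "Y \<in> {X. (constraint_vec A X, C \<bullet> X) \<in> D}"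
      then have "(constraint_vec A X, C \<bullet> X) + (constraint_vec A Y, C \<bullet> Y) \<in> D"
        using convex_cone_add[OF D(3)] by blast
      then show "X + Y \<in> {X. (constraint_vec A X, C \<bullet> X) \<in> D}"
        by (simp add: linear_add[OF linear_constraint_vec[of A]] inner_right_distrib)
    qed
    moreover have "constraint_vec A X = b" "C \<bullet> X = b \<bullet> y"
      using X(2) dual_optimal_iff[OF b(2)] by (auto simp: inner_slack)
    ultimately show ?thesis using X(1) by auto
  qed
  \<comment> \<open>Pairs on or above the hyperplane \<open>t = c \<bullet> x\<close>, where those
    on it must lie over the active hull. This convex cone contains the generators of
    \<open>D\<close>, hence \<open>D\<close>, while the normal cone lifts to points of
    \<open>D\<close> on the hyperplane.\<close>
  define E where "E = {(c, t). c \<bullet> x \<le> t \<and> (t = c \<bullet> x \<longrightarrow> c \<in> convex_cone hull ?S)}"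
  have "D \<subseteq> E"
    unfolding D_def
  proof (rule hull_minimal)
    show "(\<lambda>V. (constraint_vec A V, C \<bullet> V)) ` \<V> \<subseteq> E"
    proof clarify
      fix V assume V: "V \<in> \<V>"
      have "V \<in> active \<V> x" if "C \<bullet> V = constraint_vec A V \<bullet> x"
        using V that by (simp add: active_eq[OF psd x] inner_slack)
      then show "(constraint_vec A V, C \<bullet> V) \<in> E"
        using weak_duality[OF x, of V] V psd by (auto simp: E_def intro!: hull_inc)
    qed
    show "convex_cone E"
      unfolding convex_cone_iff
    proof (intro conjI ballI allI impI)
      show "0 \<in> E" by (simp add: E_def zero_prod_def convex_cone_hull_contains_0)
    next
      fix p q assume "p \<in> E" "q \<in> E"
      then obtain c t d s where p: "p = (c, t)" "c \<bullet> x \<le> t" "t = c \<bullet> x \<Longrightarrow> c \<in> convex_cone hull ?S"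
        and q: "q = (d, s)" "d \<bullet> x \<le> s" "s = d \<bullet> x \<Longrightarrow> d \<in> convex_cone hull ?S"
        by (auto simp: E_def)
      have "c + d \<in> convex_cone hull ?S" if "t + s = (c + d) \<bullet> x"
      proof -
        \<comment> \<open>Two nonnegative gaps with sum zero both vanish.\<close>
        have "t = c \<bullet> x" "s = d \<bullet> x" using that p(2) q(2) by (simp_all add: inner_left_distrib)
        then show ?thesis using p(3) q(3) by (simp add: convex_cone_hull_add)
      qed
      then show "p + q \<in> E" using p(1,2) q(1,2) by (simp add: E_def inner_left_distrib)
    next
      fix p and k :: real assume "p \<in> E" and k: "0 \<le> k"
      then obtain c t where p: "p = (c, t)" "c \<bullet> x \<le> t" "t = c \<bullet> x \<Longrightarrow> c \<in> convex_cone hull ?S"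
        by (auto simp: E_def)
      show "k *\<^sub>R p \<in> E"
      \<comment> \<open>Scaling by zero reaches the hyperplane even from a point strictly above it,
        so this case needs the origin of the hull.\<close>
      proof (cases "k = 0")
        case True
        then show ?thesis by (simp add: E_def zero_prod_def convex_cone_hull_contains_0)
      next
        case False
        then show ?thesis using p k by (simp add: E_def mult_left_mono convex_cone_hull_mul)
      qed
    qed
  qed
  moreover have "(b, b \<bullet> x) \<in> D" if "b \<in> normal_cone P x" for b
    by (rule support_graph_in_closed_cone[OF compact_lmi D(1,2) int that])
  ultimately show "normal_cone P x \<subseteq> convex_cone hull ?S"
    by (auto simp: E_def)
qed

text \<open>The \<open>A i\<close> are arbitrary real matrices, so a matrix of a given \<open>\<V>\<close> may have a
  nonintegral constraint vector; such matrices are replaced by finitely many combinations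
  with integral constraint vector.\<close>

lemma totally_dual_integral_integral_generators:
  assumes "totally_dual_integral_on C A int_vecs"
  obtains \<V> where "finite \<V>" "\<forall>V\<in>\<V>. int_psd V" "constraint_vec A ` \<V> \<subseteq> int_vecs"
    "\<And>b. b \<in> int_vecs \<Longrightarrow> \<exists>X\<in>nat_cone \<V>. dual_optimal C A b X"
proof -
  obtain \<V> where \<V>: "finite \<V>" "\<forall>V\<in>\<V>. int_psd V"
    and opt: "\<And>b X. b \<in> int_vecs \<Longrightarrow> dual_optimal C A b X \<Longrightarrow>
      \<exists>X. dual_optimal C A b X \<and> property_PZ \<V> X"
    using assms unfolding totally_dual_integral_on_def by blast
  define G where "G = {X. constraint_vec A X \<in> int_vecs}"
  have "X - Y \<in> G" if "X \<in> G" "Y \<in> G" for X Y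
    using that by (simp add: G_def linear_diff[OF linear_constraint_vec[of A]] int_vecs_def)
  then obtain \<W> where \<W>: "finite \<W>" "\<W> \<subseteq> nat_cone \<V> \<inter> G" "nat_cone \<V> \<inter> G \<subseteq> nat_cone \<W>"
    using nat_cone_Int_subgroup_finitely_generated[OF \<V>(1), of G] by metis
  have "nat_cone \<V> \<subseteq> {X. int_psd X}"
    using \<V>(2) by (intro nat_cone_minimal) (auto simp: int_psd_def psd_0 psd_add)
  then have "\<forall>V\<in>\<W>. int_psd V" using \<W>(2) by blast
  moreover have "constraint_vec A ` \<W> \<subseteq> int_vecs" using \<W>(2) by (auto simp: G_def)
  moreover have "\<exists>X\<in>nat_cone \<W>. dual_optimal C A b X" if b: "b \<in> int_vecs" for b
  proof -
    obtain x where x: "b \<in> normal_cone P x"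
      using normal_cone_attained[OF compact_lmi nonempty_lmi] .
    \<comment> \<open>Strong duality supplies a dual optimum for each integral \<open>b\<close>, so
      the existence premise in total dual integrality always holds.\<close>
    obtain Y where "psd Y" "constraint_vec A Y = b" "C \<bullet> Y = b \<bullet> x"
      using strong_duality[OF x] .
    then have "dual_optimal C A b Y"
      by (simp add: dual_optimal_iff[OF x] inner_slack)
    then obtain X where X: "dual_optimal C A b X" "X \<in> nat_cone \<V>"
      using opt[OF b] unfolding property_PZ_iff by blast
    then have "X \<in> G" using b by (simp add: G_def dual_optimal_iff[OF x])
    then show ?thesis using X \<W>(3) by blast
  qed
  ultimately show thesis using that \<W>(1) by blast
qed

text \<open>For integral \<open>b\<close> in the normal cone, the optimal \<open>X\<close> is
  complementary to \<open>x\<close> and so uses active matrices only;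
  \<open>constraint_vec A\<close> turns its coefficients into an integral representation of
  \<open>b\<close>.\<close>

lemma hilbert_basis_normal_cone:
  assumes fin: "finite \<V>" and psd: "\<forall>V\<in>\<V>. psd V" and x: "x \<in> P"
    and int: "constraint_vec A ` \<V> \<subseteq> int_vecs"
    and opt: "\<And>b. b \<in> int_vecs \<Longrightarrow> \<exists>X\<in>nat_cone \<V>. dual_optimal C A b X"
  shows "hilbert_basis_of (constraint_vec A ` active \<V> x) (normal_cone P x)"
proof -
  let ?S = "constraint_vec A ` active \<V> x"
  have hull: "convex_cone hull ?S = normal_cone P x"
    by (rule normal_cone_eq_active_hull[OF fin psd x opt])
  have "b \<in> nat_cone ?S" if b: "b \<in> normal_cone P x" "b \<in> int_vecs" for b
  proof -
    obtain X where X: "X \<in> nat_cone \<V>" "dual_optimal C A b X" using opt b(2) by blast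
    then have cX: "constraint_vec A X = b" "slack C A x \<bullet> X = 0"
      by (auto simp: dual_optimal_iff[OF b(1)])
    have "X \<in> nat_cone (active \<V> x)" by (rule nat_cone_active[OF fin psd x X(1) cX(2)])
    then show ?thesis
      using nat_cone_linear_image[of "active \<V> x" "constraint_vec A"] fin linear_constraint_vec cX(1)
      by auto
  qed
  moreover have "finite ?S" "?S \<subseteq> int_vecs" using fin int by auto
  ultimately show ?thesis
    unfolding hilbert_basis_of_def hilbert_basis_def hull by (auto simp: nat_cone_def)
qed

text \<open>The integral representation of \<open>b\<close> lifts to a combination of active
  matrices, which is complementary to \<open>x\<close> and hence optimal.\<close>

lemma dual_optimal_of_hilbert_basis:
  assumes fin: "finite \<V>" and psd: "\<forall>V\<in>\<V>. psd V"
    and hb: "hilbert_basis_of (constraint_vec A ` active \<V> x) (normal_cone P x)"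
    and b: "b \<in> normal_cone P x" "b \<in> int_vecs"
  shows "\<exists>X. dual_optimal C A b X \<and> property_PZ \<V> X"
proof -
  have x: "x \<in> P" using b(1) by (simp add: normal_cone_def)
  have "b \<in> nat_cone (constraint_vec A ` active \<V> x)"
    using hb b unfolding hilbert_basis_of_def hilbert_basis_def by (auto simp: nat_cone_def)
  then have "b \<in> constraint_vec A ` nat_cone (active \<V> x)"
    using nat_cone_linear_image[OF _ linear_constraint_vec, of "active \<V> x" A] fin by simp
  then obtain X where X: "X \<in> nat_cone (active \<V> x)" "constraint_vec A X = b" by blast
  have "X \<in> nat_cone \<V>" using X(1) nat_cone_mono[OF fin, of "active \<V> x"] by blast
  moreover from this have "psd X" by (rule psd_nat_cone[OF psd])
  ultimately show ?thesis
    using nat_cone_active_slack[OF psd x X(1)] X(2)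
    by (auto simp: dual_optimal_iff[OF b(1)] property_PZ_iff)
qed

end

theorem theorem6:
  fixes C :: "real^'n^'n" and A :: "'m::finite \<Rightarrow> real^'n^'n"
  assumes "transpose C = C" and "\<And>i. transpose (A i) = A i"
    and "bounded (lmi_solutions C A)"
    and "slater C A"
  shows "totally_dual_integral_on C A int_vecs \<longleftrightarrow>
    (\<exists>\<V>. finite \<V> \<and> (\<forall>V\<in>\<V>. int_psd V) \<and>
      (\<forall>xbar. xbar extreme_point_of (lmi_solutions C A) \<longrightarrow>
         normal_cone (lmi_solutions C A) xbar \<inter> int_vecs \<noteq> {} \<longrightarrow>
         hilbert_basis_of
           (constraint_vec A ` {V \<in> \<V>. col_space V \<subseteq> null_space (slack C A xbar)})
           (normal_cone (lmi_solutions C A) xbar)))"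
    (is "?tdi \<longleftrightarrow> (\<exists>\<V>. ?hilbert \<V>)")
proof -
  interpret bounded_slater_lmi C A by unfold_locales (use assms in auto)
  show ?thesis
  proof
    assume ?tdi
    then obtain \<V> where \<V>: "finite \<V>" "\<forall>V\<in>\<V>. int_psd V" "constraint_vec A ` \<V> \<subseteq> int_vecs"
      and opt: "\<And>b. b \<in> int_vecs \<Longrightarrow> \<exists>X\<in>nat_cone \<V>. dual_optimal C A b X"
      using totally_dual_integral_integral_generators by blast
    have psd: "\<forall>V\<in>\<V>. psd V" using \<V>(2) by (simp add: int_psd_def)
    have "hilbert_basis_of (constraint_vec A ` active \<V> x) (normal_cone P x)"
      if "x extreme_point_of P" for x
      using that by (intro hilbert_basis_normal_cone[OF \<V>(1) psd _ \<V>(3) opt])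
        (auto simp: extreme_point_of_def)
    then show "\<exists>\<V>. ?hilbert \<V>" using \<V>(1,2) by blast
  next
    assume "\<exists>\<V>. ?hilbert \<V>"
    then obtain \<V> where \<V>: "finite \<V>" "\<forall>V\<in>\<V>. int_psd V" and hb: "\<And>x. x extreme_point_of P \<Longrightarrow>
        normal_cone P x \<inter> int_vecs \<noteq> {} \<Longrightarrow>
        hilbert_basis_of (constraint_vec A ` active \<V> x) (normal_cone P x)"
      by blast
    have psd: "\<forall>V\<in>\<V>. psd V" using \<V>(2) by (simp add: int_psd_def)
    have "\<exists>X. dual_optimal C A b X \<and> property_PZ \<V> X" if b: "b \<in> int_vecs" for b
    proof -
      \<comment> \<open>\<open>b\<close> itself shows that the normal cone at this extreme point
        contains an integral vector, as the Hilbert basis assumption requires.\<close>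
      obtain x where x: "x extreme_point_of P" "b \<in> normal_cone P x"
        using extreme_point_normal_cone[OF compact_lmi convex_lmi nonempty_lmi] .
      then show ?thesis
        using dual_optimal_of_hilbert_basis[OF \<V>(1) psd hb x(2) b] b by blast
    qed
    then show ?tdi unfolding totally_dual_integral_on_def using \<V> by blast
  qed
qed

end
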